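(* Let $(X,\tau_1,\tau_2)$ be a $p$-normal bitopological space such that $X=\bigcup_{k=1}^\infty F_k$, where each $F_k=\bigcup_{n=1}^\infty F_n^k$ is a countable union of $p$-closed subsets $F_n^k$ of $X$, and every $F_n^k$ (with its bitopological subspace structure) is $p$-WS-supernormal in $X$ ($n,k\ge 1$). Suppose that at least one of the following holds: (a) $p\text{-}\mathrm{Ind}\,F_k=0$ for each $k\ge 1$; (b) $(X,\tau_1,\tau_2)$ is $d$-second countable and $p\text{-}\mathrm{ind}\,F_k=0$ for each $k\ge 1$. Then $p\text{-}\mathrm{Ind}\,X=0$. Moreover, if in addition both $(X,\tau_1)$ and $(X,\tau_2)$ are $T_1$, then $p\text{-}\mathrm{ind}\,X=0$.
   Context: A bitopological space $(X,\tau_1,\tau_2)$ is a set $X$ with two topologies. Always $i,j\in\{1,2\}$, $i\ne j$. "$i$-open", "$i$-closed" refer to $\tau_i$; $\mathrm{co}\,\tau_i$ is the family of $\tau_i$-closed sets. A subset $Y\subset X$ is regarded as a bitopological subspace $(Y,\tau_1',\tau_2')$ with the induced topologies. $d$-second countable: both $\tau_1$ and $\tau_2$ are second countable. $p$-closed: a set $B\subset X$ is $p$-closed if $B=B_1\cap B_2$ with $B_1\in\mathrm{co}\,\tau_1$, $B_2\in\mathrm{co}\,\tau_2$. $p$-normal: for every pair of disjoint sets $A,B$ in $X$ with $A$ 1-closed and $B$ 2-closed there are a 2-open set $U$ and a 1-open set $V$ such that $A\subset U$, $B\subset V$, $U\cap V=\varnothing$. A subspace $(Y,\tau_1',\tau_2')$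 of $(X,\tau_1,\tau_2)$ is $(i,j)$-WS-supernormal in $X$ if for each pair of disjoint sets $A\in\mathrm{co}\,\tau_i'$, $B\in\mathrm{co}\,\tau_j$ there are disjoint sets $U\in\tau_j'$, $V\in\tau_i$ such that $A\subset U$ and $B\subset V$. It is $p$-WS-supernormal in $X$ if it is both $(1,2)$- and $(2,1)$-WS-supernormal in $X$. $p\text{-}\mathrm{ind}\,X=0$ means: $\tau_1$ has a base consisting of 2-closed sets and $\tau_2$ has a base consisting of 1-closed sets. $p\text{-}\mathrm{Ind}\,X=0$ means: for every 1-closed set $F$ and every 2-open $U\supset F$ there is $V\in\tau_2\cap\mathrm{co}\,\tau_1$ with $F\subset V\subset U$, and for every 2-closed set $\Phi$ and every 1-open $U\supset\Phi$ there is $V\in\tau_1\cap\mathrm{co}\,\tau_2$ with $\Phi\subset V\subset U$. *)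

theory Defs
  imports "HOL-Analysis.Analysis"
begin

definition bitopological_space :: "'a set \<Rightarrow> 'a topology \<Rightarrow> 'a topology \<Rightarrow> bool" where
  "bitopological_space X T1 T2 \<longleftrightarrow> topspace T1 = X \<and> topspace T2 = X"

definition d_second_countable :: "'a topology \<Rightarrow> 'a topology \<Rightarrow> bool" where
  "d_second_countable T1 T2 \<longleftrightarrow> second_countable T1 \<and> second_countable T2"

definition p_closed :: "'a topology \<Rightarrow> 'a topology \<Rightarrow> 'a set \<Rightarrow> bool" where
  "p_closed T1 T2 B \<longleftrightarrow> (\<exists>B1 B2. closedin T1 B1 \<and> closedin T2 B2 \<and> B = B1 \<inter> B2)"

definition p_normal :: "'a topology \<Rightarrow> 'a topology \<Rightarrow> bool" where
  "p_normal T1 T2 \<longleftrightarrow>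
     (\<forall>A B. closedin T1 A \<and> closedin T2 B \<and> disjnt A B \<longrightarrow>
        (\<exists>U V. openin T2 U \<and> openin T1 V \<and> A \<subseteq> U \<and> B \<subseteq> V \<and> disjnt U V))"

text \<open>Being \<open>(i,j)\<close>-WS-supernormal in \<open>X\<close> is \<open>WS_supernormal_in Ti Tj Y\<close>, so the
  \<open>(2,1)\<close> version has the topologies swapped. Note the asymmetry: \<open>A\<close> and \<open>U\<close> are closed and
  open in the subspace \<open>Y\<close>, while \<open>B\<close> and \<open>V\<close> are closed and open in the whole space.\<close>

definition WS_supernormal_in :: "'a topology \<Rightarrow> 'a topology \<Rightarrow> 'a set \<Rightarrow> bool" where
  "WS_supernormal_in Ti Tj Y \<longleftrightarrow>
     (\<forall>A B. closedin (subtopology Ti Y) A \<and> closedin Tj B \<and> disjnt A B \<longrightarrow>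
        (\<exists>U V. openin (subtopology Tj Y) U \<and> openin Ti V \<and> disjnt U V \<and> A \<subseteq> U \<and> B \<subseteq> V))"

definition p_WS_supernormal_in :: "'a topology \<Rightarrow> 'a topology \<Rightarrow> 'a set \<Rightarrow> bool" where
  "p_WS_supernormal_in T1 T2 Y \<longleftrightarrow> WS_supernormal_in T1 T2 Y \<and> WS_supernormal_in T2 T1 Y"

definition is_base_of :: "'a set set \<Rightarrow> 'a topology \<Rightarrow> bool" where
  "is_base_of \<B> T \<longleftrightarrow> openin T = arbitrary union_of (\<lambda>V. V \<in> \<B>)"

text \<open>Both dimension predicates hold for the empty space; the value \<open>-1\<close> is not singled out.\<close>

definition p_ind_zero :: "'a topology \<Rightarrow> 'a topology \<Rightarrow> bool" where
  "p_ind_zero T1 T2 \<longleftrightarrow>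
     (\<exists>\<B>. is_base_of \<B> T1 \<and> (\<forall>V\<in>\<B>. closedin T2 V)) \<and>
     (\<exists>\<B>. is_base_of \<B> T2 \<and> (\<forall>V\<in>\<B>. closedin T1 V))"

definition p_Ind_zero :: "'a topology \<Rightarrow> 'a topology \<Rightarrow> bool" where
  "p_Ind_zero T1 T2 \<longleftrightarrow>
     (\<forall>F U. closedin T1 F \<and> openin T2 U \<and> F \<subseteq> U \<longrightarrow>
        (\<exists>V. openin T2 V \<and> closedin T1 V \<and> F \<subseteq> V \<and> V \<subseteq> U)) \<and>
     (\<forall>\<Phi> U. closedin T2 \<Phi> \<and> openin T1 U \<and> \<Phi> \<subseteq> U \<longrightarrow>
        (\<exists>V. openin T1 V \<and> closedin T2 V \<and> \<Phi> \<subseteq> V \<and> V \<subseteq> U))"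

end

theory Submission
  imports Defs
begin

text \<open>Given disjoint sets \<open>A\<close> (1-closed) and \<open>B\<close> (2-closed), one grows a 2-open \<open>U \<supseteq> A\<close> and a
  1-open \<open>V \<supseteq> B\<close>, keeping the 1-closure of \<open>U\<close> disjoint from the 2-closure of \<open>V\<close>, until every
  \<open>G k n\<close> is swallowed by \<open>U \<union> V\<close>; the limit of \<open>U\<close> is then 2-open and 1-closed. At each step
  \<open>Y = G k n\<close> splits as \<open>P \<union> Q\<close> because \<open>p-Ind F k = 0\<close>. WS-supernormality keeps the closures of
  \<open>P\<close> and \<open>Q\<close> away from those of \<open>V\<close> and \<open>U\<close>, and \<open>p\<close>-closedness of \<open>Y\<close> forces the 1-closure
  of \<open>P\<close> and the 2-closure of \<open>Q\<close> to meet only inside \<open>Y\<close>, hence not at all. Case (b) reduces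
  to (a): by second countability the complements of \<open>B\<close> and \<open>A\<close> are
  countable unions of sets \<open>p n\<close> and \<open>q n\<close> clopen in the mixed sense, and removing from each the
  earlier sets of the other family makes the two unions disjoint.\<close>

section \<open>Separation by sets clopen in the mixed sense, and pairwise normality\<close>

text \<open>Complementation exchanges 2-open, 1-closed sets with 1-open, 2-closed ones, so the two
  clauses of \<open>p_Ind_zero\<close> are equivalent and become one condition on disjoint
  pairs.\<close>

lemma p_Ind_zero_iff_separation:
  assumes "topspace T1 = topspace T2"
  shows "p_Ind_zero T1 T2 \<longleftrightarrow>
    (\<forall>A B. closedin T1 A \<and> closedin T2 B \<and> disjnt A B \<longrightarrow>
      (\<exists>P. openin T2 P \<and> closedin T1 P \<and> A \<subseteq> P \<and> disjnt P B))" (is "?L \<longleftrightarrow> ?R")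
proof
  assume L: ?L
  show ?R
  proof (intro allI impI)
    fix A B assume AB: "closedin T1 A \<and> closedin T2 B \<and> disjnt A B"
    then have "openin T2 (topspace T2 - B)" "A \<subseteq> topspace T2 - B"
      using closedin_subset assms by (fastforce simp: disjnt_def)+
    with L AB show "\<exists>P. openin T2 P \<and> closedin T1 P \<and> A \<subseteq> P \<and> disjnt P B"
      unfolding p_Ind_zero_def by (metis Diff_disjoint Int_commute disjnt_def disjnt_subset1)
  qed
next
  assume R: ?R
  have "\<exists>V. openin T2 V \<and> closedin T1 V \<and> F \<subseteq> V \<and> V \<subseteq> U"
    if "closedin T1 F" "openin T2 U" "F \<subseteq> U" for F U
  proof -
    have "closedin T2 (topspace T2 - U)" "disjnt F (topspace T2 - U)"
      using that by (auto simp: disjnt_def)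
    with R that(1) obtain P where
      P: "openin T2 P" "closedin T1 P" "F \<subseteq> P" "disjnt P (topspace T2 - U)" by blast
    with openin_subset[OF P(1)] show ?thesis by (auto simp: disjnt_def)
  qed
  moreover have "\<exists>V. openin T1 V \<and> closedin T2 V \<and> F \<subseteq> V \<and> V \<subseteq> U"
    if "closedin T2 F" "openin T1 U" "F \<subseteq> U" for F U
  proof -
    have "closedin T1 (topspace T1 - U)" "disjnt (topspace T1 - U) F"
      using that by (auto simp: disjnt_def)
    with R that(1) obtain P where
      P: "openin T2 P" "closedin T1 P" "topspace T1 - U \<subseteq> P" "disjnt P F" by blast
    moreover have "closedin T2 (topspace T1 - P)" "openin T1 (topspace T1 - P)"
      using P(1,2) assms by (metis closedin_diff closedin_topspace, blast)
    ultimately show ?thesis using closedin_subset[OF that(1)] assms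
      by (intro exI[of _ "topspace T1 - P"]) (fastforce simp: disjnt_def)
  qed
  ultimately show ?L unfolding p_Ind_zero_def by (intro conjI allI impI) (elim conjE, simp)+
qed

text \<open>Normality is used twice: first for a neighbourhood \<open>U\<close> of \<open>A\<close>
  whose 1-closure misses \<open>B\<close>, then to separate that closure from \<open>B\<close>. Each
  time, an open set that misses a set also misses its closure in the same topology.\<close>

lemma p_normal_closure_separation:
  assumes "p_normal T1 T2" "topspace T1 = topspace T2"
    and A: "closedin T1 A" and B: "closedin T2 B" and AB: "disjnt A B"
  obtains U V where "openin T2 U" "openin T1 V" "A \<subseteq> U" "B \<subseteq> V"
    "disjnt (T1 closure_of U) (T2 closure_of V)"
proof -
  obtain U W where U: "openin T2 U" "openin T1 W" "A \<subseteq> U" "B \<subseteq> W" "disjnt U W"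
    using assms(1) A B AB unfolding p_normal_def by metis
  then have "disjnt W (T1 closure_of U)"
    by (metis disjnt_def inf_commute openin_Int_closure_of_eq_empty)
  then have "disjnt (T1 closure_of U) B"
    using U(4) by (auto simp: disjnt_def)
  then obtain W' V where V: "openin T2 W'" "openin T1 V" "T1 closure_of U \<subseteq> W'" "B \<subseteq> V"
      "disjnt W' V"
    using assms(1) B closedin_closure_of unfolding p_normal_def by metis
  then have "disjnt W' (T2 closure_of V)"
    by (metis disjnt_def openin_Int_closure_of_eq_empty)
  then have "disjnt (T1 closure_of U) (T2 closure_of V)"
    using V(3) by (auto simp: disjnt_def)
  then show thesis using that U V by blast
qed

text \<open>Although \<open>P\<close> is closed only in \<open>Y\<close>, the neighbourhood
  \<open>V\<close> of \<open>B\<close> is open in the whole space; it misses \<open>P\<close> and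
  hence the ambient closure of \<open>P\<close>.\<close>

lemma WS_supernormal_in_closure_disjnt:
  assumes "WS_supernormal_in Ti Tj Y" "closedin (subtopology Ti Y) P" "closedin Tj B" "disjnt P B"
  shows "disjnt (Ti closure_of P) B"
proof -
  obtain U V where "openin Ti V" "disjnt U V" "P \<subseteq> U" "B \<subseteq> V"
    using assms unfolding WS_supernormal_in_def by metis
  then have "V \<inter> P = {}" by (auto simp: disjnt_def)
  with \<open>openin Ti V\<close> have "V \<inter> Ti closure_of P = {}"
    by (simp add: openin_Int_closure_of_eq_empty)
  with \<open>B \<subseteq> V\<close> show ?thesis by (auto simp: disjnt_def)
qed

text \<open>Neither closure need lie in \<open>Y\<close>, but they lie in \<open>C1\<close> and
  \<open>C2\<close> respectively, so a common point is in \<open>Y\<close>, where the closures leave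
  only \<open>P\<close> and \<open>Q\<close> as traces.\<close>

lemma p_closed_partition_closures_disjnt:
  assumes "p_closed T1 T2 Y"
    and P: "closedin (subtopology T1 Y) P" and Q: "closedin (subtopology T2 Y) Q"
    and PQ: "disjnt P Q"
  shows "disjnt (T1 closure_of P) (T2 closure_of Q)"
proof -
  obtain C1 C2 where C: "closedin T1 C1" "closedin T2 C2" "Y = C1 \<inter> C2"
    using assms(1) unfolding p_closed_def by blast
  have sub: "P \<subseteq> Y" "Q \<subseteq> Y"
    using P Q closedin_subset by fastforce+
  have "T1 closure_of P \<subseteq> C1" "T2 closure_of Q \<subseteq> C2"
    using C sub by (meson closure_of_minimal le_inf_iff order_trans)+
  moreover have "Y \<inter> T1 closure_of P = P" "Y \<inter> T2 closure_of Q = Q"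
    using P Q sub by (metis closure_of_closedin closure_of_subtopology_subset
      closure_of_subtopology inf.absorb_iff2)+
  ultimately show ?thesis using PQ C(3) unfolding disjnt_def by blast
qed

section \<open>The countable sum argument\<close>

text \<open>Dimension zero enters only through \<open>split\<close>, so all pieces can be run
  through as one sequence without reference to their grouping into the \<open>F k\<close>.\<close>

lemma p_Ind_zero_countable_sum:
  fixes Y :: "nat \<Rightarrow> 'a set"
  assumes normal: "p_normal T1 T2" and top: "topspace T1 = topspace T2"
    and cover: "topspace T1 \<subseteq> (\<Union>m. Y m)"
    and pcl: "\<And>m. p_closed T1 T2 (Y m)"
    and sup: "\<And>m. p_WS_supernormal_in T1 T2 (Y m)"
    and split: "\<And>m A B. closedin T1 A \<Longrightarrow> closedin T2 B \<Longrightarrow> disjnt A B \<Longrightarrow>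
      \<exists>P. closedin (subtopology T1 (Y m)) P \<and> closedin (subtopology T2 (Y m)) (Y m - P) \<and>
        A \<inter> Y m \<subseteq> P \<and> disjnt P B"
  shows "p_Ind_zero T1 T2"
proof -
  \<comment> \<open>Keeping the closures disjoint, not just the sets, lets them serve as the closed
    pair \<open>?A\<close>, \<open>?B\<close> of the next step.\<close>
  define good where "good = (\<lambda>(U, V). openin T2 U \<and> openin T1 V \<and>
    disjnt (T1 closure_of U) (T2 closure_of V))"
  have step: "\<exists>s'. good s' \<and> fst s \<subseteq> fst s' \<and> snd s \<subseteq> snd s' \<and> Y m \<subseteq> fst s' \<union> snd s'"
    if "good s" for s m
  proof -
    obtain U V where s: "s = (U, V)" by fastforce
    let ?A = "T1 closure_of U" and ?B = "T2 closure_of V"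
    have UV: "openin T2 U" "openin T1 V" "disjnt ?A ?B"
      using that s by (auto simp: good_def)
    have sub: "U \<subseteq> ?A" "V \<subseteq> ?B"
      using UV openin_subset top by (metis closure_of_subset)+
    obtain P where P: "closedin (subtopology T1 (Y m)) P"
        "closedin (subtopology T2 (Y m)) (Y m - P)" "?A \<inter> Y m \<subseteq> P" "disjnt P ?B"
      using split[of ?A ?B m] UV(3) by auto
    let ?Q = "Y m - P"
    have "disjnt ?Q ?A" using P(3) by (auto simp: disjnt_def)
    with P UV sup[of m] have cl: "disjnt (T1 closure_of P) ?B" "disjnt (T2 closure_of ?Q) ?A"
      unfolding p_WS_supernormal_in_def
      by (auto intro!: WS_supernormal_in_closure_disjnt)
    have clPQ: "disjnt (T1 closure_of P) (T2 closure_of ?Q)"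
      using p_closed_partition_closures_disjnt[OF pcl P(1,2)] by (auto simp: disjnt_def)
    \<comment> \<open>All four cross pairs are now disjoint. The unions are 1-closed and 2-closed,
      so normality restores the invariant around them.\<close>
    have "disjnt (?A \<union> T1 closure_of P) (?B \<union> T2 closure_of ?Q)"
      using UV(3) cl clPQ by (auto simp: disjnt_def)
    then obtain U' V' where new: "openin T2 U'" "openin T1 V'" "?A \<union> T1 closure_of P \<subseteq> U'"
        "?B \<union> T2 closure_of ?Q \<subseteq> V'" "disjnt (T1 closure_of U') (T2 closure_of V')"
      using p_normal_closure_separation[OF normal top, of "?A \<union> T1 closure_of P" "?B \<union> T2 closure_of ?Q"]
      by (metis closedin_Un closedin_closure_of)
    have "P \<subseteq> T1 closure_of P" "?Q \<subseteq> T2 closure_of ?Q"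
      using P(1,2)[THEN closedin_subset] by (auto intro!: closure_of_subset)
    then have "Y m \<subseteq> U' \<union> V'" "U \<subseteq> U'" "V \<subseteq> V'" using new sub by blast+
    with new s show ?thesis by (intro exI[of _ "(U', V')"]) (auto simp: good_def)
  qed
  have "\<exists>P. openin T2 P \<and> closedin T1 P \<and> A \<subseteq> P \<and> disjnt P B"
    if AB: "closedin T1 A" "closedin T2 B" "disjnt A B" for A B
  proof -
    obtain U0 V0 where UV0: "good (U0, V0)" "A \<subseteq> U0" "B \<subseteq> V0"
      by (rule p_normal_closure_separation[OF normal top AB]) (simp add: good_def)
    have "\<exists>f. \<forall>n. (good (f n) \<and> A \<subseteq> fst (f n) \<and> B \<subseteq> snd (f n)) \<and>
      (fst (f n) \<subseteq> fst (f (Suc n)) \<and> snd (f n) \<subseteq> snd (f (Suc n)) \<and>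
       Y n \<subseteq> fst (f (Suc n)) \<union> snd (f (Suc n)))"
    proof (rule dependent_nat_choice)
      show "\<exists>s. good s \<and> A \<subseteq> fst s \<and> B \<subseteq> snd s"
        using UV0 by (intro exI[of _ "(U0, V0)"]) auto
    next
      fix s n assume "good s \<and> A \<subseteq> fst s \<and> B \<subseteq> snd s"
      then show "\<exists>s'. (good s' \<and> A \<subseteq> fst s' \<and> B \<subseteq> snd s') \<and>
        (fst s \<subseteq> fst s' \<and> snd s \<subseteq> snd s' \<and> Y n \<subseteq> fst s' \<union> snd s')"
        using step[of s n] by (meson order_trans)
    qed
    then obtain f where f: "\<And>n. good (f n)" "\<And>n. A \<subseteq> fst (f n)" "\<And>n. B \<subseteq> snd (f n)"
        "\<And>n. fst (f n) \<subseteq> fst (f (Suc n))" "\<And>n. snd (f n) \<subseteq> snd (f (Suc n))"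
        "\<And>n. Y n \<subseteq> fst (f (Suc n)) \<union> snd (f (Suc n))"
      by metis
    define U V where "U = (\<Union>n. fst (f n))" and "V = (\<Union>n. snd (f n))"
    have op: "openin T2 (fst (f n))" "openin T1 (snd (f n))" for n
      using f(1)[of n] by (auto simp: good_def split: prod.splits)
    have opU: "openin T2 U" and opV: "openin T1 V"
      unfolding U_def V_def using op by auto
    have dis: "fst (f n) \<inter> snd (f n) = {}" for n
    proof -
      have "fst (f n) \<subseteq> T1 closure_of fst (f n)" "snd (f n) \<subseteq> T2 closure_of snd (f n)"
        using op[of n, THEN openin_subset] top by (auto intro!: closure_of_subset)
      then show ?thesis using f(1)[of n] by (auto simp: good_def disjnt_def split: prod.splits)
    qed
    have mono: "fst (f m) \<subseteq> fst (f n)" "snd (f m) \<subseteq> snd (f n)" if "m \<le> n" for m n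
      using that f(4,5) lift_Suc_mono_le[of "\<lambda>n. fst (f n)"] lift_Suc_mono_le[of "\<lambda>n. snd (f n)"]
      by auto
    have "U \<inter> V = {}"
    proof -
      \<comment> \<open>Both components increase, so stages \<open>m\<close> and \<open>n\<close>
        can be compared at stage \<open>max m n\<close>.\<close>
      have "x \<notin> snd (f n)" if "x \<in> fst (f m)" for x m n
        using that dis[of "max m n"] mono(1)[of m "max m n"] mono(2)[of n "max m n"] by auto
      then show ?thesis by (auto simp: U_def V_def)
    qed
    moreover have "topspace T1 \<subseteq> U \<union> V"
    proof
      fix x assume "x \<in> topspace T1"
      then obtain m where "x \<in> Y m" using cover by auto
      with f(6)[of m] show "x \<in> U \<union> V" unfolding U_def V_def by auto
    qed
    ultimately have "topspace T1 - V = U"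
      using openin_subset[OF opU] top by auto
    then have "closedin T1 U" using opV by (metis closedin_diff closedin_topspace)
    moreover have "A \<subseteq> U" "B \<subseteq> V" unfolding U_def V_def using f(2)[of 0] f(3)[of 0] by auto
    ultimately show ?thesis using opU \<open>U \<inter> V = {}\<close> by (auto simp: disjnt_def)
  qed
  then show ?thesis using p_Ind_zero_iff_separation[OF top] by blast
qed

section \<open>From bases to separation under second countability\<close>

lemma second_countable_clopen_cover:
  assumes "second_countable T" and base: "is_base_of \<B> T" and B: "\<forall>V\<in>\<B>. closedin S V"
    and U: "openin T U"
  shows "\<exists>f. (\<forall>n::nat. openin T (f n) \<and> closedin S (f n)) \<and> (\<Union>n. f n) = U"
proof -
  obtain \<U> where \<U>: "\<U> \<subseteq> \<B>" "\<Union>\<U> = U"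
    using U base unfolding is_base_of_def union_of_def arbitrary_def by auto
  have op: "openin T V" if "V \<in> \<B>" for V
    using base that unfolding is_base_of_def by (simp add: arbitrary_union_of_inc)
  have "Lindelof_space (subtopology T U)"
    using assms(1) second_countable_subtopology second_countable_imp_Lindelof_space by blast
  then obtain \<V> where \<V>: "countable \<V>" "\<V> \<subseteq> \<U>" "U \<subseteq> \<Union>\<V>"
    using Lindelof_space_subtopology_subset[OF openin_subset[OF U]] \<U> op
    by (smt (verit) subset_eq subset_refl)
  \<comment> \<open>The empty set is open and closed in every topology; adding it makes the family
    nonempty, so that \<open>from_nat_into\<close> enumerates it even if \<open>\<V>\<close> is
    empty.\<close>
  define f where "f = from_nat_into (insert {} \<V>)"
  have rng: "range f = insert {} \<V>"
    unfolding f_def using \<V>(1) by (simp add: range_from_nat_into)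
  then have "f n = {} \<or> f n \<in> \<B>" for n
    using \<U> \<V> rangeI[of f n] by auto
  then have "openin T (f n)" "closedin S (f n)" for n
    using op B by (metis openin_empty, metis closedin_empty)
  moreover have "(\<Union>n. f n) = U" using rng \<U> \<V> by auto
  ultimately show ?thesis by (intro exI[of _ f]) simp
qed

lemma p_ind_zero_imp_p_Ind_zero:
  assumes top: "topspace T1 = topspace T2"
    and sc: "second_countable T1" "second_countable T2" and ind: "p_ind_zero T1 T2"
  shows "p_Ind_zero T1 T2"
proof -
  obtain \<B>1 \<B>2 where
    b1: "is_base_of \<B>1 T1" "\<forall>V\<in>\<B>1. closedin T2 V" and
    b2: "is_base_of \<B>2 T2" "\<forall>V\<in>\<B>2. closedin T1 V"
    using ind unfolding p_ind_zero_def by blast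
  have "\<exists>P. openin T2 P \<and> closedin T1 P \<and> A \<subseteq> P \<and> disjnt P B"
    if AB: "closedin T1 A" "closedin T2 B" "disjnt A B" for A B
  proof -
    obtain p where p: "\<forall>n::nat. openin T2 (p n) \<and> closedin T1 (p n)"
        "(\<Union>n. p n) = topspace T2 - B"
      using second_countable_clopen_cover[OF sc(2) b2 openin_diff[OF openin_topspace AB(2)]]
      by (elim exE conjE)
    obtain q where q: "\<forall>n::nat. openin T1 (q n) \<and> closedin T2 (q n)"
        "(\<Union>n. q n) = topspace T1 - A"
      using second_countable_clopen_cover[OF sc(1) b1 openin_diff[OF openin_topspace AB(1)]]
      by (elim exE conjE)
    \<comment> \<open>The bounds \<open><\<close> and \<open>\<le>\<close> break ties in favour of
      \<open>P\<close>: for a point in \<open>p n\<close> and \<open>q m\<close>, either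
      \<open>m < n\<close> removes it from the first or \<open>n \<le> m\<close> from the second.
      Only finitely many sets, closed in the right topology, are removed from each term, so openness
      survives.\<close>
    define P where "P = (\<Union>n. p n - (\<Union>m<n. q m))"
    define Q where "Q = (\<Union>n. q n - (\<Union>m\<le>n. p m))"
    have opP: "openin T2 P" unfolding P_def
      using p q by (intro openin_Union ballI) (auto intro!: openin_diff closedin_Union)
    have opQ: "openin T1 Q" unfolding Q_def
      using p q by (intro openin_Union ballI) (auto intro!: openin_diff closedin_Union)
    have "P \<inter> Q = {}"
      unfolding P_def Q_def by auto (metis atMost_iff lessThan_iff linorder_not_less)
    moreover have "topspace T1 \<subseteq> P \<union> Q"
    proof
      fix x assume x: "x \<in> topspace T1"
      then have "x \<in> (\<Union>n. p n) \<or> x \<in> (\<Union>n. q n)"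
        unfolding p(2) q(2) using AB(3) top by (auto simp: disjnt_def)
      then have ex: "\<exists>n. x \<in> p n \<or> x \<in> q n" by auto
      \<comment> \<open>At the first index where \<open>x\<close> occurs nothing earlier can remove
        it: it enters \<open>P\<close> if it is in \<open>p n\<close>, and otherwise
        \<open>Q\<close>.\<close>
      define n where "n = (LEAST n. x \<in> p n \<or> x \<in> q n)"
      have "x \<in> p n \<or> x \<in> q n" unfolding n_def using LeastI_ex[OF ex] .
      moreover have "x \<notin> p m \<and> x \<notin> q m" if "m < n" for m
        using that not_less_Least[of m "\<lambda>n. x \<in> p n \<or> x \<in> q n"] unfolding n_def by blast
      ultimately have "x \<in> p n - (\<Union>m<n. q m) \<or> x \<in> q n - (\<Union>m\<le>n. p m)"
        by (auto simp: le_less)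
      then show "x \<in> P \<union> Q" unfolding P_def Q_def by blast
    qed
    ultimately have "topspace T1 - Q = P"
      using openin_subset[OF opP] top by auto
    then have "closedin T1 P" using opQ by (metis closedin_diff closedin_topspace)
    moreover have "disjnt P B" using p(2) by (auto simp: P_def disjnt_def)
    moreover have "A \<subseteq> P"
    proof -
      have "A \<inter> Q = {}" using q(2) by (auto simp: Q_def)
      then show ?thesis
        using closedin_subset[OF AB(1)] \<open>topspace T1 \<subseteq> P \<union> Q\<close> by auto
    qed
    ultimately show ?thesis using opP by blast
  qed
  then show ?thesis using p_Ind_zero_iff_separation[OF top] by blast
qed

section \<open>Restriction to a piece, passage to bases, and assembly\<close>

lemma p_Ind_zero_subset_partition:
  assumes top: "topspace T1 = topspace T2"
    and Ind: "p_Ind_zero (subtopology T1 F) (subtopology T2 F)" and Y: "Y \<subseteq> F"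
      "Y \<subseteq> topspace T1"
    and AB: "closedin T1 A" "closedin T2 B" "disjnt A B"
  shows "\<exists>P. closedin (subtopology T1 Y) P \<and> closedin (subtopology T2 Y) (Y - P) \<and>
    A \<inter> Y \<subseteq> P \<and> disjnt P B"
proof -
  have "closedin (subtopology T1 F) (A \<inter> F)" "closedin (subtopology T2 F) (B \<inter> F)"
    using AB by (auto simp: closedin_subtopology)
  moreover have "disjnt (A \<inter> F) (B \<inter> F)" using AB by (auto simp: disjnt_def)
  ultimately obtain P where P: "openin (subtopology T2 F) P" "closedin (subtopology T1 F) P"
      "A \<inter> F \<subseteq> P" "disjnt P (B \<inter> F)"
    using Ind p_Ind_zero_iff_separation[of "subtopology T1 F" "subtopology T2 F"] top
    by (metis topspace_subtopology)
  \<comment> \<open>Ambient descriptions of \<open>P\<close> in both topologies allow it to be cut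
    down to \<open>Y\<close>: \<open>C\<close> gives the trace of \<open>P\<close>, the complement
    of \<open>W\<close> the rest of \<open>Y\<close>.\<close>
  obtain C W where C: "closedin T1 C" "P = C \<inter> F" and W: "openin T2 W" "P = W \<inter> F"
    using P by (auto simp: closedin_subtopology openin_subtopology)
  have "closedin (subtopology T1 Y) (P \<inter> Y)"
    unfolding closedin_subtopology using C Y by blast
  moreover have "Y - P \<inter> Y = (topspace T2 - W) \<inter> Y" using W Y top by auto
  then have "closedin (subtopology T2 Y) (Y - P \<inter> Y)"
    unfolding closedin_subtopology using W by blast
  moreover have "A \<inter> Y \<subseteq> P \<inter> Y" "disjnt (P \<inter> Y) B"
    using P(3,4) Y(1) unfolding disjnt_def by blast+
  ultimately show ?thesis by metis
qed

text \<open>Singletons are closed in a T1 space, so separating \<open>{x}\<close> inside an open set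
  gives a basic neighbourhood of \<open>x\<close>.\<close>

lemma p_Ind_zero_imp_p_ind_zero:
  assumes "p_Ind_zero T1 T2" "topspace T1 = topspace T2" "t1_space T1" "t1_space T2"
  shows "p_ind_zero T1 T2"
proof -
  have base: "is_base_of {V. openin S V \<and> closedin T V} S"
    if sep: "\<And>C U. closedin T C \<Longrightarrow> openin S U \<Longrightarrow> C \<subseteq> U \<Longrightarrow>
        \<exists>V. openin S V \<and> closedin T V \<and> C \<subseteq> V \<and> V \<subseteq> U"
      and T: "t1_space T" "topspace S = topspace T" for S T :: "'a topology"
    unfolding is_base_of_def
  proof (rule ext, rule iffI)
    fix U assume U: "openin S U"
    have "\<exists>V. openin S V \<and> closedin T V \<and> x \<in> V \<and> V \<subseteq> U" if "x \<in> U" for x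
    proof -
      have "closedin T {x}"
        using T U that openin_subset by (fastforce simp: t1_space_closedin_singleton)
      then show ?thesis using sep[of "{x}" U] U that by auto
    qed
    then show "(arbitrary union_of (\<lambda>V. V \<in> {V. openin S V \<and> closedin T V})) U"
      unfolding arbitrary_union_of_alt by simp
  next
    fix U assume "(arbitrary union_of (\<lambda>V. V \<in> {V. openin S V \<and> closedin T V})) U"
    then show "openin S U" by (auto simp: union_of_def)
  qed
  have "is_base_of {V. openin T1 V \<and> closedin T2 V} T1"
       "is_base_of {V. openin T2 V \<and> closedin T1 V} T2"
    using assms by (auto simp: p_Ind_zero_def intro!: base)
  then show ?thesis unfolding p_ind_zero_def by blast
qed

theorem corollary2p26:
  fixes X :: "'a set" and T1 T2 :: "'a topology"
    and F :: "nat \<Rightarrow> 'a set" and G :: "nat \<Rightarrow> nat \<Rightarrow> 'a set"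
  assumes "bitopological_space X T1 T2"
    and "p_normal T1 T2"
    and "X = (\<Union>k\<in>{1..}. F k)"
    and "\<And>k. k \<ge> 1 \<Longrightarrow> F k = (\<Union>n\<in>{1..}. G k n)"
    and "\<And>k n. k \<ge> 1 \<Longrightarrow> n \<ge> 1 \<Longrightarrow> p_closed T1 T2 (G k n)"
    and "\<And>k n. k \<ge> 1 \<Longrightarrow> n \<ge> 1 \<Longrightarrow> p_WS_supernormal_in T1 T2 (G k n)"
    and "(\<forall>k\<ge>1. p_Ind_zero (subtopology T1 (F k)) (subtopology T2 (F k))) \<or>
         (d_second_countable T1 T2 \<and>
          (\<forall>k\<ge>1. p_ind_zero (subtopology T1 (F k)) (subtopology T2 (F k))))"
  shows "p_Ind_zero T1 T2 \<and> (t1_space T1 \<and> t1_space T2 \<longrightarrow> p_ind_zero T1 T2)"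
proof -
  have top: "topspace T1 = X" "topspace T2 = X"
    using assms(1) by (auto simp: bitopological_space_def)
  \<comment> \<open>Second countability passes to each \<open>F k\<close>, so case (b) is reduced to
    (a) on every \<open>F k\<close> separately.\<close>
  have Ind: "p_Ind_zero (subtopology T1 (F k)) (subtopology T2 (F k))" if "k \<ge> 1" for k
    using assms(7)
  proof
    assume "d_second_countable T1 T2 \<and>
      (\<forall>k\<ge>1. p_ind_zero (subtopology T1 (F k)) (subtopology T2 (F k)))"
    with that top show ?thesis
      by (auto simp: d_second_countable_def
        intro!: p_ind_zero_imp_p_Ind_zero second_countable_subtopology)
  qed (use that in blast)
  \<comment> \<open>The pairing starts at 0 and the given families at 1, hence the two
    \<open>Suc\<close>.\<close>
  define Y where "Y m = (case prod_decode m of (k, n) \<Rightarrow> G (Suc k) (Suc n))" for m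
  have Y: "\<exists>k n. k \<ge> 1 \<and> n \<ge> 1 \<and> Y m = G k n" for m
    unfolding Y_def by (cases "prod_decode m") force
  have "p_Ind_zero T1 T2"
  proof (rule p_Ind_zero_countable_sum[OF assms(2)])
    show "topspace T1 \<subseteq> (\<Union>m. Y m)"
    proof
      fix x assume "x \<in> topspace T1"
      then obtain k n where kn: "k \<ge> 1" "n \<ge> 1" "x \<in> G k n"
        using top assms(3,4) by auto
      then have "x \<in> Y (prod_encode (k - 1, n - 1))" by (simp add: Y_def)
      then show "x \<in> (\<Union>m. Y m)" by blast
    qed
    show "p_closed T1 T2 (Y m)" "p_WS_supernormal_in T1 T2 (Y m)" for m
      using Y[of m] assms(5,6) by auto
    fix m A B assume AB: "closedin T1 A" "closedin T2 B" "disjnt A B"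
    obtain k n where kn: "k \<ge> 1" "n \<ge> 1" "Y m = G k n" using Y by blast
    have "Y m \<subseteq> F k" using kn assms(4) by auto
    moreover have "F k \<subseteq> topspace T1" using kn top assms(3) by auto
    ultimately show "\<exists>P. closedin (subtopology T1 (Y m)) P \<and>
        closedin (subtopology T2 (Y m)) (Y m - P) \<and> A \<inter> Y m \<subseteq> P \<and> disjnt P B"
      using p_Ind_zero_subset_partition[OF _ Ind[OF kn(1)] _ _ AB] top by auto
  qed (use top in simp)
  then show ?thesis using p_Ind_zero_imp_p_ind_zero top by blast
qed

end
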